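(* Fix $d\ge1$. For $n\ge3$ let $\chi_n(x)$ be the chromatic polynomial of the $d$-dimensional toroidal grid graph $T^d_n$, and for $k\ge0$ let $q_k(n^d)$ denote the coefficient of $x^{n^d-k}$ in $\chi_n(x)$. Then for each $k$ there are a polynomial $P_k$ and an integer $n_k$ such that $(-1)^kq_k(n^d)=P_k(n^d)$ for all $n\ge n_k$, and the sequence of polynomials $P_0,P_1,P_2,\dots$ is of binomial type.
   Context: $T^d_n=(C_n)^d$ is the graph with vertex set $(\mathbb{Z}/n\mathbb{Z})^d$ in which two vertices are adjacent iff they differ by $\pm1$ in exactly one coordinate and agree in all others. A sequence of polynomials $P_0,P_1,P_2,\dots$ is of binomial type if $P_0=1$, $P_i(0)=0$ for $i>0$, and $\left(\sum_{i\ge0}P_i(1)x^i\right)^m=\sum_{i\ge0}P_i(m)x^i$ for all nonnegative integers $m$; the third condition may equivalently be replaced by $P_k(x+y)=\sum_{i=0}^kP_i(x)P_{k-i}(y)$ for all $k\ge 0$ (no binomial coefficients in this convention). *)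

theory Defs
  imports
    "HOL-Computational_Algebra.Polynomial"
    "HOL-Computational_Algebra.Formal_Power_Series"
    "HOL-Number_Theory.Cong"
    "HOL-Library.FuncSet"
    Complex_Main
begin

text \<open>A graph is given by a vertex set \<open>V\<close> and an adjacency relation \<open>adj\<close>,
  which is only relevant on \<open>V\<close>.\<close>

definition proper_colorings :: "'a set \<Rightarrow> ('a \<Rightarrow> 'a \<Rightarrow> bool) \<Rightarrow> nat \<Rightarrow> ('a \<Rightarrow> nat) set" where
  "proper_colorings V adj q =
     {c \<in> V \<rightarrow>\<^sub>E {..<q}. \<forall>u\<in>V. \<forall>v\<in>V. adj u v \<longrightarrow> c u \<noteq> c v}"

definition chromatic_poly :: "'a set \<Rightarrow> ('a \<Rightarrow> 'a \<Rightarrow> bool) \<Rightarrow> int poly" where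
  "chromatic_poly V adj =
     (THE p. \<forall>q. poly p (int q) = int (card (proper_colorings V adj q)))"

text \<open>The description is well-defined for finite \<open>V\<close>; existence is by deletion and
  contraction on the set of arcs.\<close>

lemma ex_chromatic_poly_arcs:
  assumes "finite E" "finite V" "E \<subseteq> V \<times> V"
  shows "\<exists>p. \<forall>q. poly p (int q) = int (card {c \<in> V \<rightarrow>\<^sub>E {..<q}. \<forall>(u,v)\<in>E. c u \<noteq> c v})"
  using assms
proof (induction "card E" arbitrary: V E rule: less_induct)
  case less
  show ?case
  proof (cases "E = {}")
    case True
    have "poly (monom 1 (card V)) (int q) = int (card (V \<rightarrow>\<^sub>E {..<q}))" for q
      using less.prems(2) by (simp add: poly_monom card_PiE)
    then show ?thesis using True by auto
  next
    case False
    then obtain u v where uv: "(u,v) \<in> E" by auto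
    define F where "F = E - {(u,v)}"
    have E: "E = insert (u,v) F" using uv by (auto simp: F_def)
    have F: "finite F" "F \<subseteq> V \<times> V" "card F < card E" "u \<in> V" "v \<in> V"
      using less.prems uv card_Diff1_less[OF less.prems(1) uv] by (auto simp: F_def)
    show ?thesis
    proof (cases "u = v")
      case True
      then show ?thesis using uv by (intro exI[of _ 0]) (auto simp: card_eq_0_iff)
    next
      case neq: False
      define r where "r x = (if x = v then u else x)" for x
      define F' where "F' = map_prod r r ` F"
      have rV: "r x \<in> V - {v}" if "x \<in> V" for x using that F(4) neq by (simp add: r_def)
      have "finite F'" using F(1) by (simp add: F'_def)
      moreover have "F' \<subseteq> (V - {v}) \<times> (V - {v})"
      proof
        fix z assume "z \<in> F'"
        then obtain a b where ab: "(a,b) \<in> F" "z = (r a, r b)" unfolding F'_def by auto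
        then have "a \<in> V" "b \<in> V" using F(2) by blast+
        then show "z \<in> (V - {v}) \<times> (V - {v})" unfolding ab(2) using rV by blast
      qed
      moreover have "card F' < card E"
        unfolding F'_def using card_image_le[OF F(1)] F(3) by (rule order.strict_trans1)
      ultimately have F': "finite F'" "F' \<subseteq> (V - {v}) \<times> (V - {v})" "card F' < card E"
        by blast+
      obtain p1 where p1: "\<And>q. poly p1 (int q) =
          int (card {c \<in> V \<rightarrow>\<^sub>E {..<q}. \<forall>(a,b)\<in>F. c a \<noteq> c b})"
        using less.hyps[OF F(3,1) less.prems(2) F(2)] by blast
      obtain p2 where p2: "\<And>q. poly p2 (int q) =
          int (card {c \<in> (V - {v}) \<rightarrow>\<^sub>E {..<q}. \<forall>(a,b)\<in>F'. c a \<noteq> c b})"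
        using less.hyps[OF F'(3,1) _ F'(2)] less.prems(2) by blast
      have "poly (p1 - p2) (int q) = int (card {c \<in> V \<rightarrow>\<^sub>E {..<q}. \<forall>(a,b)\<in>E. c a \<noteq> c b})" for q
      proof -
        let ?A = "{c \<in> V \<rightarrow>\<^sub>E {..<q}. \<forall>(a,b)\<in>F. c a \<noteq> c b}"
        let ?B = "{c \<in> V \<rightarrow>\<^sub>E {..<q}. \<forall>(a,b)\<in>E. c a \<noteq> c b}"
        let ?D = "{c \<in> (V - {v}) \<rightarrow>\<^sub>E {..<q}. \<forall>(a,b)\<in>F'. c a \<noteq> c b}"
        let ?C = "{c \<in> ?A. c u = c v}"
        have fin: "finite ?A"
          using less.prems(2) by (auto intro: finite_subset[OF _ finite_PiE[of V "\<lambda>_. {..<q}"]])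
        have A: "?A = ?B \<union> ?C" by (auto simp: E)
        have "?B \<inter> ?C = {}" by (auto simp: E)
        moreover have "finite ?B" by (rule finite_subset[OF _ fin]) (auto simp: E)
        moreover have "finite ?C" by (rule finite_subset[OF _ fin]) auto
        ultimately have "card (?B \<union> ?C) = card ?B + card ?C"
          by (intro card_Un_disjoint)
        with arg_cong[OF A, of card] have 1: "card ?A = card ?B + card ?C" by (rule trans)
        have eqr: "c (r x) = c x" if "c u = c v" for x and c :: "'a \<Rightarrow> nat"
          using that by (simp add: r_def)
        have F'_iff: "(\<forall>(a,b)\<in>F'. c a \<noteq> c b) \<longleftrightarrow> (\<forall>(a,b)\<in>F. c (r a) \<noteq> c (r b))"
          for c :: "'a \<Rightarrow> nat" by (force simp: F'_def)
        have "bij_betw (\<lambda>c. restrict c (V - {v})) ?C ?D"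
        proof (rule bij_betw_byWitness[where f' = "\<lambda>c. restrict (c \<circ> r) V"])
          show "\<forall>c\<in>?C. restrict (restrict c (V - {v}) \<circ> r) V = c"
          proof
            fix c assume "c \<in> ?C"
            then have c: "c \<in> V \<rightarrow>\<^sub>E {..<q}" "c u = c v" by blast+
            show "restrict (restrict c (V - {v}) \<circ> r) V = c"
              using rV eqr[OF c(2)] PiE_arb[OF c(1)] by (intro ext) (simp add: restrict_def)
          qed
          show "\<forall>c\<in>?D. restrict (restrict (c \<circ> r) V) (V - {v}) = c"
          proof (intro ballI ext)
            fix c x assume "c \<in> ?D"
            then have "c \<in> (V - {v}) \<rightarrow>\<^sub>E {..<q}" by blast
            from PiE_arb[OF this, of x] show "restrict (restrict (c \<circ> r) V) (V - {v}) x = c x"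
              by (simp add: restrict_def r_def)
          qed
          show "(\<lambda>c. restrict c (V - {v})) ` ?C \<subseteq> ?D"
          proof (rule image_subsetI)
            fix c assume c: "c \<in> ?C"
            have eq: "restrict c (V - {v}) (r x) = c x" if "x \<in> V" for x
              using rV[OF that] eqr[of c x] c by simp
            have "restrict c (V - {v}) (r a) \<noteq> restrict c (V - {v}) (r b)" if "(a,b) \<in> F" for a b
            proof -
              have "a \<in> V" "b \<in> V" using that F(2) by blast+
              moreover have "c a \<noteq> c b" using c that by blast
              ultimately show ?thesis by (simp only: eq not_False_eq_True)
            qed
            moreover have "restrict c (V - {v}) \<in> (V - {v}) \<rightarrow>\<^sub>E {..<q}"
              using c by (simp add: PiE_iff)
            ultimately show "restrict c (V - {v}) \<in> ?D" unfolding mem_Collect_eq F'_iff by blast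
          qed
          show "(\<lambda>c. restrict (c \<circ> r) V) ` ?D \<subseteq> ?C"
          proof (rule image_subsetI)
            fix c assume c: "c \<in> ?D"
            have "restrict (c \<circ> r) V \<in> V \<rightarrow>\<^sub>E {..<q}" using c rV by (simp add: PiE_iff)
            moreover have "restrict (c \<circ> r) V u = restrict (c \<circ> r) V v"
              using F(4,5) by (simp add: r_def)
            moreover have "restrict (c \<circ> r) V a \<noteq> restrict (c \<circ> r) V b" if "(a,b) \<in> F" for a b
            proof -
              have "a \<in> V" "b \<in> V" using that F(2) by blast+
              moreover have "c (r a) \<noteq> c (r b)"
                using c that unfolding mem_Collect_eq F'_iff by blast
              ultimately show ?thesis by simp
            qed
            ultimately show "restrict (c \<circ> r) V \<in> ?C" by blast
          qed
        qed
        then have "card ?C = card ?D" by (rule bij_betw_same_card)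
        then show ?thesis using 1 by (simp add: p1 p2)
      qed
      then show ?thesis by blast
    qed
  qed
qed

lemma poly_chromatic_poly:
  assumes "finite V"
  shows "poly (chromatic_poly V adj) (int q) = int (card (proper_colorings V adj q))"
proof -
  let ?E = "{(u,v). u \<in> V \<and> v \<in> V \<and> adj u v}"
  have "?E \<subseteq> V \<times> V" by auto
  moreover from this have "finite ?E" using assms by (simp add: finite_subset)
  moreover have "{c \<in> V \<rightarrow>\<^sub>E {..<q}. \<forall>(u,v)\<in>?E. c u \<noteq> c v} = proper_colorings V adj q" for q
    by (auto simp: proper_colorings_def)
  ultimately obtain p where p: "\<forall>q. poly p (int q) = int (card (proper_colorings V adj q))"
    using ex_chromatic_poly_arcs[of ?E V] assms by auto
  have "p' = p" if "\<forall>q. poly p' (int q) = int (card (proper_colorings V adj q))" for p'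
  proof (rule ccontr)
    assume "p' \<noteq> p"
    then have "finite {x. poly (p' - p) x = 0}" by (intro poly_roots_finite) simp
    moreover have "range int \<subseteq> {x. poly (p' - p) x = 0}" using p that by auto
    ultimately show False using finite_subset range_inj_infinite[of int] by (auto simp: inj_on_def)
  qed
  then show ?thesis
    unfolding chromatic_poly_def
    using theI[of "\<lambda>p. \<forall>q. poly p (int q) = int (card (proper_colorings V adj q))", OF p] by simp
qed

text \<open>The elements of $\mathbb{Z}/n\mathbb{Z}$ are represented by \<open>0, \<dots>, n - 1\<close> and
  coordinates are indexed by \<open>0, \<dots>, d - 1\<close>.\<close>

definition torus_verts :: "nat \<Rightarrow> nat \<Rightarrow> (nat \<Rightarrow> int) set" where
  "torus_verts d n = {..<d} \<rightarrow>\<^sub>E {0..<int n}"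

definition torus_adj :: "nat \<Rightarrow> nat \<Rightarrow> (nat \<Rightarrow> int) \<Rightarrow> (nat \<Rightarrow> int) \<Rightarrow> bool" where
  "torus_adj d n u v \<longleftrightarrow>
     (\<exists>i<d. ([u i - v i = 1] (mod int n) \<or> [u i - v i = -1] (mod int n)) \<and>
            (\<forall>j<d. j \<noteq> i \<longrightarrow> u j = v j))"

definition torus_chromatic_poly :: "nat \<Rightarrow> nat \<Rightarrow> int poly" where
  "torus_chromatic_poly d n = chromatic_poly (torus_verts d n) (torus_adj d n)"

text \<open>The guard makes the coefficient of a negative power of \<open>x\<close> zero, where
  subtraction on \<^typ>\<open>nat\<close> would truncate.\<close>

definition torus_coeff :: "nat \<Rightarrow> nat \<Rightarrow> nat \<Rightarrow> int" where
  "torus_coeff d n k =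
     (if k \<le> n ^ d then coeff (torus_chromatic_poly d n) (n ^ d - k) else 0)"

definition binomial_type :: "(nat \<Rightarrow> 'a::comm_ring_1 poly) \<Rightarrow> bool" where
  "binomial_type P \<longleftrightarrow>
     P 0 = 1 \<and>
     (\<forall>i>0. poly (P i) 0 = 0) \<and>
     (\<forall>m::nat. Abs_fps (\<lambda>i. poly (P i) 1) ^ m = Abs_fps (\<lambda>i. poly (P i) (of_nat m)))"

end

theory Submission imports Defs begin

unbundle fps_syntax

text \<open>
  Write \<open>F\<^sub>S(t)\<close> for the series whose \<open>k\<close>-th coefficient is \<open>(-1)\<^sup>k\<close> times the coefficient
  of \<open>x\<close> to the power \<open>|S| - k\<close> in the chromatic polynomial of the subgraph induced on
  \<open>S\<close>.  Over disjoint vertex sets without edges between them the chromatic polynomial is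
  multiplicative, so the logarithmic derivative \<open>D\<^sub>S = F\<^sub>S' / F\<^sub>S\<close> is additive.  The
  theorem follows once the logarithm is known to be extensive: for each \<open>k\<close> there is a constant
  \<open>M\<^sub>k\<close> such that the \<open>k\<close>-th coefficient of \<open>D\<close> for the whole torus is exactly
  \<open>n\<^sup>d M\<^sub>k\<close> as soon as \<open>n\<close> is large (\<open>log_deriv_torus\<close>).  Indeed, solving
  \<open>F' = D F\<close> coefficient by coefficient then gives the coefficients of \<open>F\<close> as the values at
  \<open>n\<^sup>d\<close> of the polynomials \<open>P\<^sub>k(x)\<close> with generating series \<open>exp (x L(t))\<close>, where
  \<open>L' = \<Sum>\<^sub>k M\<^sub>k t\<^sup>k\<close>, and such a sequence is of binomial type (\<open>binomial_type_exp_poly\<close>).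

  Extensivity is a cluster expansion carried out on vertex sets.  Moebius inversion writes
  \<open>D\<^sub>V = \<Sum>\<^sub>T \<phi>(T)\<close>, the sum ranging over all \<open>T \<subseteq> V\<close>.  Three properties of the
  \<open>k\<close>-th coefficient of \<open>\<phi>\<close> matter.  It is invariant under graph isomorphism.  It vanishes
  if \<open>T\<close> is disconnected, because \<open>D\<close> is additive (\<open>cumulant_disconnected\<close>).  And it
  vanishes if \<open>|T| > 2(k + 1)\<close> (\<open>cumulant_large\<close>).  So only connected sets of bounded size
  contribute.  The torus is vertex transitive, so the sum is \<open>n\<^sup>d\<close> times a sum over sets that
  contain one given vertex, each weighted by \<open>1 / |T|\<close>; those sets lie in a box around that vertex,
  and for large \<open>n\<close> the torus looks on this box like the infinite grid, whatever \<open>n\<close> is.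

  The bound on the size of \<open>T\<close> is the heart of the matter.  The Moebius inverse at \<open>W\<close> of the
  number of colourings of \<open>W\<close> that are proper on \<open>U\<close> counts, with bounded weights, only those
  colourings in which every vertex shares its colour with another one, since a vertex without such
  a partner has no influence on whether a colouring is proper.  These use at most \<open>|W| / 2\<close> of
  the \<open>q\<close> colours, so there are \<open>O(q\<^bsup>|W|/2\<^esup>)\<close> of them
  (\<open>degree_moebius_chromatic_poly\<close>).  Hence the Moebius inverse of the \<open>k\<close>-th coefficient of
  \<open>F\<close> vanishes on sets with more than \<open>2k\<close> elements, and this passes to \<open>D\<close> through the
  recursion \<open>F' = D F\<close>.
\<close>

section \<open>Moebius inversion for set functions\<close>

definition moebius :: "('a set \<Rightarrow> 'b::comm_ring_1) \<Rightarrow> 'a set \<Rightarrow> 'b" where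
  "moebius g T = (\<Sum>U\<in>Pow T. (-1) ^ (card T - card U) * g U)"

lemma sum_Pow_moebius:
  assumes "finite S"
  shows "(\<Sum>T\<in>Pow S. moebius g T) = g S"
proof -
  \<comment> \<open>Splitting the sign \<open>(-1)\<^bsup>|T|-|U|\<^esup>\<close> into two factors makes the inversion symmetric.\<close>
  define h where "h T = (\<Sum>U\<in>Pow T. (-1) ^ card U * g U)" for T
  have "(-1) ^ card T * h T = moebius g T" if "T \<in> Pow S" for T
  proof -
    have "finite T" using that assms by (auto intro: finite_subset)
    then have "(-1) ^ card T * ((-1) ^ card U * g U) = (-1) ^ (card T - card U) * g U"
      if "U \<in> Pow T" for U
      using that card_mono[of T U]
      by (simp add: mult.assoc[symmetric] power_add[symmetric] neg_one_power_add_eq_neg_one_power_diff)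
    then show ?thesis
      unfolding h_def moebius_def sum_distrib_left by (rule sum.cong[OF refl])
  qed
  moreover have "g S = (\<Sum>T\<in>Pow S. (-1) ^ card T * h T)"
    by (rule inclusion_exclusion_symmetric) (auto simp: h_def assms)
  ultimately show ?thesis by simp
qed

lemma moebius_cong:
  assumes "\<And>U. U \<subseteq> T \<Longrightarrow> g U = h U"
  shows "moebius g T = moebius h T"
  unfolding moebius_def using assms by (intro sum.cong) auto

lemma moebius_add: "moebius (\<lambda>U. g U + h U) T = moebius g T + moebius h T"
  by (simp add: moebius_def ring_distribs sum.distrib)

lemma moebius_image:
  assumes "inj_on f T"
  shows "moebius g (f ` T) = moebius (\<lambda>U. g (f ` U)) T"
proof -
  have "moebius g (f ` T) = (\<Sum>U\<in>(`) f ` Pow T. (-1) ^ (card (f ` T) - card U) * g U)"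
    by (simp add: moebius_def image_Pow_surj)
  also have "\<dots> = (\<Sum>U\<in>Pow T. (-1) ^ (card (f ` T) - card (f ` U)) * g (f ` U))"
    using inj_on_image_Pow[OF assms] by (simp add: sum.reindex)
  also have "\<dots> = moebius (\<lambda>U. g (f ` U)) T"
    unfolding moebius_def using assms
    by (intro sum.cong refl) (auto simp: card_image inj_on_subset)
  finally show ?thesis .
qed

text \<open>
  If \<open>g\<close> does not see the element \<open>x\<close>, the terms for \<open>U\<close> and for \<open>U\<close> with \<open>x\<close> added
  cancel in pairs.  The cumulants vanish on disconnected and on large sets because of this
  cancellation.
\<close>

lemma moebius_eq_0_if_ignores:
  assumes "finite T" "x \<in> T"
    and "\<And>U. U \<subseteq> T - {x} \<Longrightarrow> g (insert x U) = g U"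
  shows "moebius g T = 0"
proof -
  define R where "R = T - {x}"
  have T: "T = insert x R" "x \<notin> R" "finite R" using assms by (auto simp: R_def)
  have "moebius g T = (\<Sum>U\<in>Pow R. (-1) ^ (card T - card U) * g U) +
      (\<Sum>U\<in>insert x ` Pow R. (-1) ^ (card T - card U) * g U)"
    unfolding moebius_def T(1) Pow_insert using T by (intro sum.union_disjoint) auto
  also have "(\<Sum>U\<in>insert x ` Pow R. (-1) ^ (card T - card U) * g U) =
      (\<Sum>U\<in>Pow R. (-1) ^ (card T - card (insert x U)) * g (insert x U))"
    using T(2) by (subst sum.reindex) (auto simp: inj_on_def)
  also have "\<dots> = (\<Sum>U\<in>Pow R. - ((-1) ^ (card T - card U) * g U))"
  proof (intro sum.cong refl)
    fix U assume U: "U \<in> Pow R"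
    then have "finite U" "x \<notin> U" using T by (auto intro: finite_subset)
    moreover have "card T - card U = Suc (card T - card (insert x U))"
      using T U card_mono[of R U] \<open>finite U\<close> \<open>x \<notin> U\<close> by auto
    moreover have "g (insert x U) = g U" using assms(3) U by (auto simp: R_def)
    ultimately show "(-1) ^ (card T - card (insert x U)) * g (insert x U) =
        - ((-1) ^ (card T - card U) * g U)" by simp
  qed
  finally show ?thesis by (simp add: sum_negf)
qed

text \<open>
  On subsets of \<open>A \<union> B\<close>, such a \<open>g\<close> is a sum of a function that does not see any element of
  \<open>B\<close> and one that does not see any element of \<open>A\<close>.
\<close>

lemma moebius_eq_0_if_additive:
  assumes "finite A" "finite B" "A \<inter> B = {}" "A \<noteq> {}" "B \<noteq> {}"
    and add: "\<And>U W. U \<subseteq> A \<Longrightarrow> W \<subseteq> B \<Longrightarrow> g (U \<union> W) = g U + g W"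
  shows "moebius g (A \<union> B) = 0"
proof -
  have "g U = g (U \<inter> A) + g (U \<inter> B)" if "U \<subseteq> A \<union> B" for U
    using add[of "U \<inter> A" "U \<inter> B"] that
    by (simp add: Int_Un_distrib[symmetric] Int_absorb2)
  then have "moebius g (A \<union> B) =
      moebius (\<lambda>U. g (U \<inter> A)) (A \<union> B) + moebius (\<lambda>U. g (U \<inter> B)) (A \<union> B)"
    by (simp add: moebius_add[symmetric] cong: moebius_cong)
  moreover obtain a b where "a \<in> A" "b \<in> B" using assms by blast
  moreover from this have "a \<notin> B" "b \<notin> A" using assms by blast+
  ultimately show ?thesis
    using assms(1,2) moebius_eq_0_if_ignores[of "A \<union> B" b "\<lambda>U. g (U \<inter> A)"]
      moebius_eq_0_if_ignores[of "A \<union> B" a "\<lambda>U. g (U \<inter> B)"]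
    by (simp add: Int_insert_left)
qed

text \<open>
  A set function is a polynomial in the indicator variables of the elements, with one multilinear
  monomial per set \<open>T\<close>, whose coefficient is the Moebius inverse at \<open>T\<close>.  The definition
  bounds the degree of this polynomial.
\<close>

definition set_degree_le :: "nat \<Rightarrow> ('a set \<Rightarrow> 'b::comm_ring_1) \<Rightarrow> bool" where
  "set_degree_le m g \<longleftrightarrow> (\<forall>T. finite T \<longrightarrow> m < card T \<longrightarrow> moebius g T = 0)"

text \<open>
  Indicator variables are idempotent, so the product of the monomials of \<open>X\<close> and \<open>Y\<close> is the
  monomial of \<open>X \<union> Y\<close>, which has at most \<open>|X| + |Y|\<close> elements.
\<close>

lemma set_degree_le_mult:
  assumes "set_degree_le m g" "set_degree_le l h"
  shows "set_degree_le (m + l) (\<lambda>S. g S * h S)"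
  unfolding set_degree_le_def
proof (intro allI impI)
  fix T :: "'a set" assume T: "finite T" "m + l < card T"
  \<comment> \<open>Collecting the pairs by their union gives the Moebius inverse of the product.\<close>
  define c where "c Z = (\<Sum>(X, Y) | X \<subseteq> Z \<and> Y \<subseteq> Z \<and> X \<union> Y = Z. moebius g X * moebius h Y)" for Z
  have "(\<Sum>Z\<in>Pow S. c Z) = g S * h S" if S: "finite S" for S
  proof -
    have "g S * h S = (\<Sum>(X, Y)\<in>Pow S \<times> Pow S. moebius g X * moebius h Y)"
      by (simp add: sum_Pow_moebius[OF S, symmetric] sum_product sum.cartesian_product)
    also have "\<dots> = (\<Sum>Z\<in>Pow S. \<Sum>(X, Y)\<in>{p \<in> Pow S \<times> Pow S. fst p \<union> snd p = Z}.
        moebius g X * moebius h Y)"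
      using S by (intro sum.group[symmetric]) auto
    also have "\<dots> = (\<Sum>Z\<in>Pow S. c Z)"
      unfolding c_def by (intro sum.cong refl) auto
    finally show ?thesis by simp
  qed
  then have "c T = moebius (\<lambda>S. g S * h S) T"
    unfolding moebius_def by (intro inclusion_exclusion_mobius T) simp
  moreover have "c T = 0"
    unfolding c_def
  proof (intro sum.neutral ballI, clarify)
    fix X Y assume "X \<subseteq> X \<union> Y" "Y \<subseteq> X \<union> Y" "T = X \<union> Y"
    then have "finite X" "finite Y" "m < card X \<or> l < card Y"
      using T card_Un_le[of X Y] by auto
    then show "moebius g X * moebius h Y = 0"
      using assms by (auto simp: set_degree_le_def)
  qed
  ultimately show "moebius (\<lambda>S. g S * h S) T = 0" by simp
qed

lemma moebius_linear:
  "moebius (\<lambda>S. c * g S - (\<Sum>i\<in>I. h i S)) T = c * moebius g T - (\<Sum>i\<in>I. moebius (h i) T)"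
proof -
  have "(\<Sum>U\<in>Pow T. \<Sum>i\<in>I. (-1) ^ (card T - card U) * h i U) =
      (\<Sum>i\<in>I. \<Sum>U\<in>Pow T. (-1) ^ (card T - card U) * h i U)"
    by (rule sum.swap)
  then show ?thesis
    by (simp add: moebius_def right_diff_distrib sum_subtractf sum_distrib_left mult.left_commute)
qed

section \<open>Colourings with few colours\<close>

text \<open>
  A polynomial divided by the power of the variable with its degree as exponent tends to the leading
  coefficient, while the assumed bound would make this quotient tend to zero if the degree exceeded
  \<open>m\<close>.
\<close>

lemma degree_le_if_poly_bound:
  fixes p :: "int poly" and C :: int
  assumes "\<And>q. q \<ge> q0 \<Longrightarrow> \<bar>poly p (int q)\<bar> \<le> C * int q ^ m"
  shows "degree p \<le> m"
proof (rule ccontr)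
  assume "\<not> degree p \<le> m"
  then have deg: "m < degree p" by simp
  define r where "r = map_poly real_of_int p"
  have r: "degree r = degree p" "poly r (real q) = real_of_int (poly p (int q))" for q
    by (simp_all add: r_def degree_map_poly poly_altdef coeff_map_poly)
  have "((\<lambda>q. poly r (real q) / real q ^ degree r) \<longlongrightarrow> lead_coeff r) sequentially"
    by (rule filterlim_compose[OF poly_divide_tendsto_aux tendsto_of_nat])
  moreover have "((\<lambda>q. poly r (real q) / real q ^ degree r) \<longlongrightarrow> 0) sequentially"
  proof (rule tendsto_0_le[OF lim_inverse_n])
    show "\<forall>\<^sub>F q in sequentially.
        norm (poly r (real q) / real q ^ degree r) \<le> norm (inverse (real q)) * \<bar>real_of_int C\<bar>"
      using eventually_ge_at_top[of "max q0 1"]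
    proof eventually_elim
      fix q assume q: "max q0 1 \<le> q"
      have "\<bar>poly r (real q)\<bar> = real_of_int \<bar>poly p (int q)\<bar>" by (simp add: r)
      also have "\<dots> \<le> real_of_int (C * int q ^ m)" using assms[of q] q by (subst of_int_le_iff) simp
      finally have "\<bar>poly r (real q)\<bar> \<le> \<bar>real_of_int C\<bar> * real q ^ m" 
        using abs_ge_self[of "real_of_int C"] by (simp add: order.trans[OF _ mult_right_mono])
      moreover have "real q ^ Suc m \<le> real q ^ degree r" using deg r(1) q by (intro power_increasing) auto
      ultimately have "\<bar>poly r (real q)\<bar> / real q ^ degree r \<le> \<bar>real_of_int C\<bar> * real q ^ m / real q ^ Suc m"
        using q by (intro frac_le) auto
      then show "norm (poly r (real q) / real q ^ degree r) \<le> norm (inverse (real q)) * \<bar>real_of_int C\<bar>"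
        using q by (simp add: field_simps)
    qed
  qed
  ultimately have "lead_coeff r = 0" by (rule LIMSEQ_unique)
  then have "degree r = 0" by simp
  then show False using deg r(1) by simp
qed

text \<open>
  There are at most \<open>q\<^sup>m\<close> ways to choose \<open>m\<close> colours that contain all the colours in use.
\<close>

lemma card_PiE_card_image_le:
  assumes "finite W" "m \<le> q"
  shows "card {c \<in> W \<rightarrow>\<^sub>E {..<q}. card (c ` W) \<le> m} \<le> q ^ m * m ^ card W"
proof -
  let ?M = "{M. M \<subseteq> {..<q} \<and> card M = m}"
  have fin: "finite ?M" by (rule finite_subset[of _ "Pow {..<q}"]) auto
  have "{c \<in> W \<rightarrow>\<^sub>E {..<q}. card (c ` W) \<le> m} \<subseteq> (\<Union>M\<in>?M. W \<rightarrow>\<^sub>E M)"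
  proof
    fix c assume "c \<in> {c \<in> W \<rightarrow>\<^sub>E {..<q}. card (c ` W) \<le> m}"
    then have c: "c \<in> W \<rightarrow>\<^sub>E {..<q}" "card (c ` W) \<le> m" by auto
    have sub: "c ` W \<subseteq> {..<q}" using c(1) by (auto simp: PiE_iff)
    have "m \<le> card {..<q}" using assms(2) by simp
    from exists_subset_between[OF c(2) this sub]
    obtain M where "c ` W \<subseteq> M" "M \<subseteq> {..<q}" "card M = m" by auto
    moreover from this have "c \<in> W \<rightarrow>\<^sub>E M" using c(1) by (auto simp: PiE_iff)
    ultimately show "c \<in> (\<Union>M\<in>?M. W \<rightarrow>\<^sub>E M)" by auto
  qed
  then have "card {c \<in> W \<rightarrow>\<^sub>E {..<q}. card (c ` W) \<le> m} \<le> card (\<Union>M\<in>?M. W \<rightarrow>\<^sub>E M)"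
    using fin assms(1) by (intro card_mono finite_UN_I finite_PiE) (auto intro: finite_subset)
  also have "\<dots> \<le> (\<Sum>M\<in>?M. card (W \<rightarrow>\<^sub>E M))" using fin by (rule card_UN_le)
  also have "\<dots> = (q choose m) * m ^ card W"
    using assms(1) by (simp add: card_PiE n_subsets)
  also have "\<dots> \<le> q ^ m * m ^ card W"
    using binomial_le_pow[OF assms(2)] by simp
  finally show ?thesis .
qed

lemma card_image_le_half:
  assumes "finite W" and mate: "\<And>v. v \<in> W \<Longrightarrow> \<exists>u\<in>W. u \<noteq> v \<and> c u = c v"
  shows "card (c ` W) \<le> card W div 2"
proof -
  have "2 \<le> card {x \<in> W. c x = y}" if y: "y \<in> c ` W" for y
  proof -
    obtain v where v: "v \<in> W" "c v = y" using y by auto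
    obtain u where u: "u \<in> W" "u \<noteq> v" "c u = c v" using mate[OF v(1)] by auto
    have "card {u, v} \<le> card {x \<in> W. c x = y}"
      using u v assms(1) by (intro card_mono) auto
    then show ?thesis using u by simp
  qed
  then have "(\<Sum>y\<in>c ` W. 2) \<le> (\<Sum>y\<in>c ` W. card {x \<in> W. c x = y})" by (rule sum_mono)
  also have "\<dots> = card W"
    using sum.image_gen[OF assms(1), of "\<lambda>_. 1::nat" c] by simp
  finally show ?thesis by simp
qed

section \<open>Chromatic polynomials of induced subgraphs\<close>

lemma int_poly_eqI:
  fixes p r :: "int poly"
  assumes "\<And>q. poly p (int q) = poly r (int q)"
  shows "p = r"
proof (rule ccontr)
  assume "p \<noteq> r"
  then have "finite {x. poly (p - r) x = 0}" by (intro poly_roots_finite) simp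
  moreover have "range int \<subseteq> {x. poly (p - r) x = 0}" using assms by auto
  ultimately show False using finite_subset range_inj_infinite[of int] by (auto simp: inj_on_def)
qed

text \<open>
  Without edges between \<open>A\<close> and \<open>B\<close>, a proper colouring of the union is an arbitrary pair
  of proper colourings of the parts.
\<close>

lemma card_proper_colorings_Un:
  assumes "A \<inter> B = {}" and sep: "\<And>u v. u \<in> A \<Longrightarrow> v \<in> B \<Longrightarrow> \<not> adj u v \<and> \<not> adj v u"
  shows "card (proper_colorings (A \<union> B) adj q) =
    card (proper_colorings A adj q) * card (proper_colorings B adj q)"
proof -
  have notB: "x \<notin> B" if "x \<in> A" for x using assms(1) that by auto
  then have notA: "x \<notin> A" if "x \<in> B" for x using that by auto
  have "bij_betw (\<lambda>c. (restrict c A, restrict c B)) (proper_colorings (A \<union> B) adj q)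
      (proper_colorings A adj q \<times> proper_colorings B adj q)"
  proof (rule bij_betw_byWitness[where f' = "\<lambda>(c, e). \<lambda>x. if x \<in> A then c x else e x"])
    show "\<forall>c\<in>proper_colorings (A \<union> B) adj q.
        (\<lambda>(c, e). \<lambda>x. if x \<in> A then c x else e x) (restrict c A, restrict c B) = c"
      by (auto simp: proper_colorings_def PiE_iff extensional_def restrict_def fun_eq_iff)
    show "\<forall>p\<in>proper_colorings A adj q \<times> proper_colorings B adj q.
        (\<lambda>c. (restrict c A, restrict c B)) ((\<lambda>(c, e). \<lambda>x. if x \<in> A then c x else e x) p) = p"
      using notB
      by (auto simp: proper_colorings_def PiE_iff extensional_def restrict_def fun_eq_iff)
    show "(\<lambda>c. (restrict c A, restrict c B)) ` proper_colorings (A \<union> B) adj q \<subseteq>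
        proper_colorings A adj q \<times> proper_colorings B adj q"
      by (auto simp: proper_colorings_def PiE_iff)
    show "(\<lambda>(c, e). \<lambda>x. if x \<in> A then c x else e x) `
        (proper_colorings A adj q \<times> proper_colorings B adj q) \<subseteq> proper_colorings (A \<union> B) adj q"
      using sep notA by (auto simp: proper_colorings_def PiE_iff extensional_def)
  qed
  then show ?thesis by (simp add: bij_betw_same_card card_cartesian_product)
qed

lemma chromatic_poly_Un:
  assumes "finite A" "finite B" "A \<inter> B = {}"
    and "\<And>u v. u \<in> A \<Longrightarrow> v \<in> B \<Longrightarrow> \<not> adj u v \<and> \<not> adj v u"
  shows "chromatic_poly (A \<union> B) adj = chromatic_poly A adj * chromatic_poly B adj"
  using assms by (intro int_poly_eqI) (simp add: poly_chromatic_poly card_proper_colorings_Un)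

lemma chromatic_poly_cong:
  assumes "\<And>u v. u \<in> S \<Longrightarrow> v \<in> S \<Longrightarrow> adj u v \<longleftrightarrow> adj' u v"
  shows "chromatic_poly S adj = chromatic_poly S adj'"
proof -
  have "proper_colorings S adj q = proper_colorings S adj' q" for q
    using assms by (auto simp: proper_colorings_def)
  then show ?thesis by (simp add: chromatic_poly_def)
qed

lemma chromatic_poly_image:
  assumes "finite S" "inj_on f S"
  shows "chromatic_poly (f ` S) adj = chromatic_poly S (\<lambda>u v. adj (f u) (f v))"
proof (rule int_poly_eqI)
  fix q
  define h where "h = the_inv_into S f"
  have h: "h (f x) = x" if "x \<in> S" for x
    using that assms(2) by (simp add: h_def the_inv_into_f_f)
  have "bij_betw (\<lambda>c. restrict (c \<circ> f) S) (proper_colorings (f ` S) adj q)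
      (proper_colorings S (\<lambda>u v. adj (f u) (f v)) q)"
  proof (rule bij_betw_byWitness[where f' = "\<lambda>c. restrict (c \<circ> h) (f ` S)"])
    show "\<forall>c\<in>proper_colorings (f ` S) adj q.
        restrict (restrict (c \<circ> f) S \<circ> h) (f ` S) = c"
      by (auto simp: proper_colorings_def PiE_iff extensional_def restrict_def fun_eq_iff h)
    show "\<forall>c\<in>proper_colorings S (\<lambda>u v. adj (f u) (f v)) q.
        restrict (restrict (c \<circ> h) (f ` S) \<circ> f) S = c"
      by (auto simp: proper_colorings_def PiE_iff extensional_def restrict_def fun_eq_iff h)
  qed (auto simp: proper_colorings_def PiE_iff h)
  then show "poly (chromatic_poly (f ` S) adj) (int q) =
      poly (chromatic_poly S (\<lambda>u v. adj (f u) (f v))) (int q)"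
    using assms(1) by (simp add: poly_chromatic_poly bij_betw_same_card)
qed

text \<open>
  Deleting every edge that is not inside \<open>U\<close> turns this into a count of proper colourings of a
  graph in which the vertices outside \<open>U\<close> are isolated.
\<close>

lemma card_colorings_proper_on:
  assumes "finite W" "U \<subseteq> W"
  shows "card {c \<in> W \<rightarrow>\<^sub>E {..<q}. \<forall>u\<in>U. \<forall>v\<in>U. adj u v \<longrightarrow> c u \<noteq> c v} =
    q ^ (card W - card U) * card (proper_colorings U adj q)"
proof -
  let ?adj = "\<lambda>u v. adj u v \<and> u \<in> U \<and> v \<in> U"
  have "{c \<in> W \<rightarrow>\<^sub>E {..<q}. \<forall>u\<in>U. \<forall>v\<in>U. adj u v \<longrightarrow> c u \<noteq> c v} =
      proper_colorings (U \<union> (W - U)) ?adj q"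
    using assms(2) by (auto simp: proper_colorings_def Un_absorb1)
  also have "card \<dots> = card (proper_colorings U ?adj q) * card (proper_colorings (W - U) ?adj q)"
    by (rule card_proper_colorings_Un) auto
  also have "proper_colorings U ?adj q = proper_colorings U adj q"
    by (auto simp: proper_colorings_def)
  also have "proper_colorings (W - U) ?adj q = (W - U) \<rightarrow>\<^sub>E {..<q}"
    by (auto simp: proper_colorings_def)
  also have "card ((W - U) \<rightarrow>\<^sub>E {..<q}) = q ^ (card W - card U)"
    using assms finite_subset[OF assms(2,1)] by (simp add: card_PiE card_Diff_subset)
  finally show ?thesis by simp
qed

lemma neg_one_power_mult_poly: "(-1) ^ n * p = smult ((-1) ^ n) (p :: 'a::comm_ring_1 poly)"
  by (induction n) (simp_all add: mult.assoc)

lemma poly_moebius: "poly (moebius g W) x = moebius (\<lambda>U. poly (g U) x) W"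
  by (simp add: moebius_def poly_sum neg_one_power_mult_poly)

lemma coeff_moebius: "coeff (moebius g W) i = moebius (\<lambda>U. coeff (g U) i) W"
  by (simp add: moebius_def coeff_sum neg_one_power_mult_poly)

lemma abs_moebius_le:
  fixes g :: "'a set \<Rightarrow> int"
  assumes "finite W" "\<And>U. U \<subseteq> W \<Longrightarrow> \<bar>g U\<bar> \<le> 1"
  shows "\<bar>moebius g W\<bar> \<le> 2 ^ card W"
proof -
  have "\<bar>moebius g W\<bar> \<le> (\<Sum>U\<in>Pow W. \<bar>(-1) ^ (card W - card U) * g U\<bar>)"
    unfolding moebius_def by (rule sum_abs)
  also have "\<dots> \<le> (\<Sum>U\<in>Pow W. 1)"
    using assms(2) by (intro sum_mono) (auto simp: abs_mult power_abs)
  finally show ?thesis using assms(1) by (simp add: card_Pow)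
qed

text \<open>
  The value at \<open>q\<close> is a sum over all colourings \<open>c\<close> of \<open>W\<close> with \<open>q\<close> colours of the
  Moebius inverse at \<open>W\<close> of the function that tells whether \<open>c\<close> is proper on a set \<open>U\<close>.
  A vertex whose colour occurs nowhere else in \<open>W\<close> makes this inverse zero.  In the remaining
  colourings every colour class has at least two elements, and their number grows like
  \<open>q\<close> to the power \<open>|W| / 2\<close> at most.
\<close>

lemma degree_moebius_chromatic_poly:
  assumes "finite W" and irrefl: "irreflp adj"
  shows "degree (moebius (\<lambda>U. monom 1 (card W - card U) * chromatic_poly U adj) W) \<le> card W div 2"
    (is "degree ?a \<le> ?m")
proof (rule degree_le_if_poly_bound)
  fix q assume q: "?m \<le> q"
  define ok where "ok c U \<longleftrightarrow> (\<forall>u\<in>U. \<forall>v\<in>U. adj u v \<longrightarrow> c u \<noteq> c v)" for c :: "'a \<Rightarrow> nat" and U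
  let ?X = "W \<rightarrow>\<^sub>E {..<q}"
  let ?I = "\<lambda>c U. of_bool (ok c U) :: int"
  let ?Y = "{c \<in> ?X. card (c ` W) \<le> ?m}"
  have finX: "finite ?X" using assms(1) by (simp add: finite_PiE)
  \<comment> \<open>A vertex \<open>v\<close> with a colour of its own never violates properness.\<close>
  have zero: "moebius (?I c) W = 0" if c: "c \<in> ?X - ?Y" for c
  proof -
    obtain v where v: "v \<in> W" "\<And>u. u \<in> W \<Longrightarrow> u \<noteq> v \<Longrightarrow> c u \<noteq> c v"
      using c card_image_le_half[OF assms(1), of c] by auto
    have "ok c (insert v U) \<longleftrightarrow> ok c U" if "U \<subseteq> W - {v}" for U
      using v that irreflpD[OF irrefl] unfolding ok_def by (metis DiffE insertCI insertE singletonI subsetD)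
    then show ?thesis by (intro moebius_eq_0_if_ignores[OF assms(1) v(1)]) simp
  qed
  have "poly ?a (int q) = moebius (\<lambda>U. \<Sum>c\<in>?X. ?I c U) W"
    unfolding poly_moebius
  proof (rule moebius_cong)
    fix U assume U: "U \<subseteq> W"
    then have "finite U" using assms(1) finite_subset by blast
    then have "poly (monom 1 (card W - card U) * chromatic_poly U adj) (int q) =
        int (q ^ (card W - card U) * card (proper_colorings U adj q))"
      by (simp add: poly_monom poly_chromatic_poly)
    also have "\<dots> = int (card {c \<in> ?X. ok c U})"
      using card_colorings_proper_on[OF assms(1) U] by (simp add: ok_def)
    also have "\<dots> = (\<Sum>c\<in>?X. ?I c U)"
      using finX by (simp add: sum_of_bool_eq Int_def)
    finally show "poly (monom 1 (card W - card U) * chromatic_poly U adj) (int q) = \<dots>" .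
  qed
  also have "\<dots> = (\<Sum>c\<in>?X. moebius (?I c) W)"
    unfolding moebius_def sum_distrib_left by (rule sum.swap)
  also have "\<dots> = (\<Sum>c\<in>?Y. moebius (?I c) W)"
    using finX zero by (intro sum.mono_neutral_right) auto
  finally have "\<bar>poly ?a (int q)\<bar> \<le> (\<Sum>c\<in>?Y. \<bar>moebius (?I c) W\<bar>)" by simp
  also have "\<dots> \<le> (\<Sum>c\<in>?Y. 2 ^ card W)"
    using assms(1) by (intro sum_mono abs_moebius_le) auto
  also have "\<dots> = int (card ?Y) * 2 ^ card W" by simp
  also have "\<dots> \<le> int (q ^ ?m * ?m ^ card W) * 2 ^ card W"
    using card_PiE_card_image_le[OF assms(1) q] by (intro mult_right_mono) (simp only: of_nat_le_iff, simp)
  finally show "\<bar>poly ?a (int q)\<bar> \<le> (int (?m ^ card W) * 2 ^ card W) * int q ^ ?m"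
    by (simp add: mult_ac)
qed

text \<open>
  The induced subgraph's chromatic polynomial read from the top coefficient downwards, with the
  alternating signs removed.
\<close>

definition chrom_series :: "('a \<Rightarrow> 'a \<Rightarrow> bool) \<Rightarrow> 'a set \<Rightarrow> real fps" where
  "chrom_series adj S = Abs_fps (\<lambda>k. (-1) ^ k *
     of_int (if k \<le> card S then coeff (chromatic_poly S adj) (card S - k) else 0))"

text \<open>
  Shifting by the power \<open>x\<^bsup>|W|-|U|\<^esup>\<close> brings the coefficients of \<open>x\<^bsup>|U|-k\<^esup>\<close> in the
  chromatic polynomials of all \<open>U \<subseteq> W\<close> to the same exponent \<open>|W| - k\<close>.  That exponent is
  larger than the bound \<open>|W| / 2\<close> on the degree of their alternating sum when \<open>|W| > 2k\<close>.
\<close>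

lemma set_degree_chrom_series:
  assumes "irreflp adj"
  shows "set_degree_le (2 * k) (\<lambda>S. chrom_series adj S $ k)"
  unfolding set_degree_le_def
proof (intro allI impI)
  fix W :: "'a set" assume W: "finite W" "2 * k < card W"
  let ?g = "\<lambda>U. monom 1 (card W - card U) * chromatic_poly U adj"
  have "moebius (\<lambda>S. chrom_series adj S $ k) W =
      moebius (\<lambda>U. (-1) ^ k * of_int (coeff (?g U) (card W - k))) W"
  proof (rule moebius_cong)
    fix U assume "U \<subseteq> W"
    then have "card U \<le> card W" using W(1) by (simp add: card_mono)
    then show "chrom_series adj U $ k = (-1) ^ k * of_int (coeff (?g U) (card W - k))"
      using W(2) by (auto simp: chrom_series_def coeff_monom_mult not_less)
  qed
  also have "\<dots> = (-1) ^ k * of_int (coeff (moebius ?g W) (card W - k))"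
    by (simp add: coeff_moebius) (simp add: moebius_def sum_distrib_left mult.left_commute)
  also have "coeff (moebius ?g W) (card W - k) = 0"
    using degree_moebius_chromatic_poly[OF W(1) assms] W(2) by (intro coeff_eq_0) linarith
  finally show "moebius (\<lambda>S. chrom_series adj S $ k) W = 0" by simp
qed

lemma chromatic_poly_empty: "chromatic_poly {} adj = 1"
  by (rule int_poly_eqI) (simp add: poly_chromatic_poly proper_colorings_def)

lemma chrom_series_empty: "chrom_series adj {} = 1"
  by (rule fps_ext) (auto simp: chrom_series_def chromatic_poly_empty)

text \<open>
  For \<open>k = 0\<close> the degree bound says that the coefficient is a constant function of the set, and
  its value is found on the empty set.
\<close>

lemma chrom_series_nth_0:
  assumes "finite S" "irreflp adj"
  shows "chrom_series adj S $ 0 = 1"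
proof -
  have "chrom_series adj S $ 0 = (\<Sum>T\<in>Pow S. moebius (\<lambda>S. chrom_series adj S $ 0) T)"
    by (simp add: sum_Pow_moebius assms(1))
  also have "\<dots> = (\<Sum>T\<in>{{}}. moebius (\<lambda>S. chrom_series adj S $ 0) T)"
  proof (intro sum.mono_neutral_right ballI)
    fix T assume "T \<in> Pow S - {{}}"
    then have "finite T" "T \<noteq> {}" using assms(1) by (auto intro: finite_subset)
    then show "moebius (\<lambda>S. chrom_series adj S $ 0) T = 0"
      using set_degree_chrom_series[OF assms(2), of 0]
      by (simp add: set_degree_le_def card_gt_0_iff)
  qed (use assms in auto)
  finally show ?thesis by (simp add: moebius_def chrom_series_empty)
qed

lemma degree_chromatic_poly:
  assumes "finite S" "irreflp adj"
  shows "degree (chromatic_poly S adj) = card S"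
proof (rule antisym)
  show "degree (chromatic_poly S adj) \<le> card S"
  proof (rule degree_le_if_poly_bound[where C = 1 and ?q0.0 = 0])
    fix q
    have "card (proper_colorings S adj q) \<le> card (S \<rightarrow>\<^sub>E {..<q})"
      using assms(1) by (intro card_mono finite_PiE) (auto simp: proper_colorings_def)
    also have "\<dots> = q ^ card S" using assms(1) by (simp add: card_PiE)
    finally show "\<bar>poly (chromatic_poly S adj) (int q)\<bar> \<le> 1 * int q ^ card S"
      using assms(1) by (simp add: poly_chromatic_poly flip: of_nat_power)
  qed
  show "card S \<le> degree (chromatic_poly S adj)"
    using chrom_series_nth_0[OF assms] by (intro le_degree) (auto simp: chrom_series_def)
qed

text \<open>
  Since the degree of the chromatic polynomial is the number of vertices, the series is, up to
  signs, the reflected polynomial, and reflection is multiplicative.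
\<close>

lemma chrom_series_Un:
  assumes "finite A" "finite B" "A \<inter> B = {}" "irreflp adj"
    and "\<And>u v. u \<in> A \<Longrightarrow> v \<in> B \<Longrightarrow> \<not> adj u v \<and> \<not> adj v u"
  shows "chrom_series adj (A \<union> B) = chrom_series adj A * chrom_series adj B"
proof (rule fps_ext)
  fix k
  have nth: "chrom_series adj S $ k = (-1) ^ k * of_int (coeff (reflect_poly (chromatic_poly S adj)) k)"
    if "finite S" for S k
    using that assms(4) by (simp add: chrom_series_def coeff_reflect_poly degree_chromatic_poly)
  have "(chrom_series adj A * chrom_series adj B) $ k = (\<Sum>i\<le>k. (-1) ^ k *
      of_int (coeff (reflect_poly (chromatic_poly A adj)) i * coeff (reflect_poly (chromatic_poly B adj)) (k - i)))"
    unfolding fps_mult_nth atLeast0AtMost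
  proof (intro sum.cong refl)
    fix i assume "i \<in> {..k}"
    then have "(-1) ^ k = (-1) ^ i * (-1 :: real) ^ (k - i)" by (simp flip: power_add)
    then show "chrom_series adj A $ i * chrom_series adj B $ (k - i) = (-1) ^ k *
      of_int (coeff (reflect_poly (chromatic_poly A adj)) i * coeff (reflect_poly (chromatic_poly B adj)) (k - i))"
      using assms(1,2) by (simp add: nth)
  qed
  also have "\<dots> = (-1) ^ k * of_int (coeff (reflect_poly (chromatic_poly (A \<union> B) adj)) k)"
    using assms by (simp add: chromatic_poly_Un reflect_poly_mult coeff_mult sum_distrib_left)
  also have "\<dots> = chrom_series adj (A \<union> B) $ k" using assms(1,2) by (simp add: nth)
  finally show "chrom_series adj (A \<union> B) $ k = (chrom_series adj A * chrom_series adj B) $ k" by simp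
qed

section \<open>The logarithmic derivative and its Moebius inverse\<close>

definition log_deriv :: "('a \<Rightarrow> 'a \<Rightarrow> bool) \<Rightarrow> 'a set \<Rightarrow> real fps" where
  "log_deriv adj S = fps_deriv (chrom_series adj S) * inverse (chrom_series adj S)"

text \<open>
  The equation \<open>F' = D F\<close> coefficientwise: it determines \<open>D\<close> from \<open>F\<close>, and \<open>F\<close> from \<open>D\<close>.
\<close>

lemma log_deriv_recursion:
  assumes "finite S" "irreflp adj"
  shows "real (Suc k) * chrom_series adj S $ Suc k =
    (\<Sum>j\<le>k. log_deriv adj S $ j * chrom_series adj S $ (k - j))"
proof -
  have "log_deriv adj S * chrom_series adj S = fps_deriv (chrom_series adj S)"
    using inverse_mult_eq_1[of "chrom_series adj S"] chrom_series_nth_0[OF assms]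
    by (simp add: log_deriv_def mult.assoc)
  then have "(log_deriv adj S * chrom_series adj S) $ k = fps_deriv (chrom_series adj S) $ k"
    by simp
  then show ?thesis by (simp add: fps_mult_nth atLeast0AtMost)
qed

lemma log_deriv_empty: "log_deriv adj {} = 0"
  by (simp add: log_deriv_def chrom_series_empty)

lemma log_deriv_Un:
  assumes "finite A" "finite B" "A \<inter> B = {}" "irreflp adj"
    and "\<And>u v. u \<in> A \<Longrightarrow> v \<in> B \<Longrightarrow> \<not> adj u v \<and> \<not> adj v u"
  shows "log_deriv adj (A \<union> B) = log_deriv adj A + log_deriv adj B"
proof -
  define f g where "f = chrom_series adj A" and "g = chrom_series adj B"
  have inv: "f * inverse f = 1" "g * inverse g = 1"
    using chrom_series_nth_0[OF assms(1,4)] chrom_series_nth_0[OF assms(2,4)]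
    by (simp_all add: f_def g_def inverse_mult_eq_1')
  have "log_deriv adj (A \<union> B) = fps_deriv (f * g) * inverse (f * g)"
    by (simp add: log_deriv_def f_def g_def chrom_series_Un assms)
  also have "\<dots> = fps_deriv f * inverse f * (g * inverse g) + fps_deriv g * inverse g * (f * inverse f)"
    by (simp add: fps_inverse_mult algebra_simps)
  finally show ?thesis unfolding inv by (simp add: log_deriv_def f_def g_def)
qed

text \<open>
  In the recursion for the \<open>k\<close>-th coefficient of \<open>D\<close>, the term with index \<open>k + 1\<close> of
  \<open>F\<close> has degree at most \<open>2(k + 1)\<close>, and so has each product of the coefficients \<open>j\<close> of
  \<open>D\<close> and \<open>k - j\<close> of \<open>F\<close>, by induction.
\<close>

lemma set_degree_log_deriv:
  assumes "irreflp adj"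
  shows "set_degree_le (2 * Suc k) (\<lambda>S. log_deriv adj S $ k)"
proof (induction k rule: less_induct)
  case (less k)
  show ?case
    unfolding set_degree_le_def
  proof (intro allI impI)
    fix T :: "'a set" assume T: "finite T" "2 * Suc k < card T"
    let ?F = "\<lambda>i S. chrom_series adj S $ i"
    let ?D = "\<lambda>i S. log_deriv adj S $ i"
    have "moebius (?D k) T = moebius (\<lambda>S. real (Suc k) * ?F (Suc k) S - (\<Sum>j<k. ?D j S * ?F (k - j) S)) T"
    proof (rule moebius_cong)
      fix U assume "U \<subseteq> T"
      then have "finite U" using T(1) finite_subset by blast
      then show "?D k U = real (Suc k) * ?F (Suc k) U - (\<Sum>j<k. ?D j U * ?F (k - j) U)"
        using chrom_series_nth_0[of U adj]
        by (simp only: log_deriv_recursion assms) (simp add: assms flip: lessThan_Suc_atMost)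
    qed
    also have "\<dots> = real (Suc k) * moebius (?F (Suc k)) T - (\<Sum>j<k. moebius (\<lambda>S. ?D j S * ?F (k - j) S) T)"
      by (rule moebius_linear)
    also have "moebius (?F (Suc k)) T = 0"
      using set_degree_chrom_series[OF assms, of "Suc k"] T by (simp only: set_degree_le_def)
    also have "(\<Sum>j<k. moebius (\<lambda>S. ?D j S * ?F (k - j) S) T) = 0"
    proof (intro sum.neutral ballI)
      fix j assume "j \<in> {..<k}"
      then have jk: "j < k" by simp
      have "set_degree_le (2 * Suc j + 2 * (k - j)) (\<lambda>S. ?D j S * ?F (k - j) S)"
        by (intro set_degree_le_mult less.IH jk set_degree_chrom_series assms)
      moreover have "2 * Suc j + 2 * (k - j) = 2 * Suc k" using jk by simp
      ultimately show "moebius (\<lambda>S. ?D j S * ?F (k - j) S) T = 0"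
        using T by (simp only: set_degree_le_def)
    qed
    finally show "moebius (?D k) T = 0" by simp
  qed
qed

text \<open>
  The \<open>k\<close>-th coefficient of the series \<open>\<phi>(T)\<close> of the introduction.  The name is
  that of the analogous quantities in probability: contributions to the logarithm of a generating
  function that vanish when \<open>T\<close> falls into independent parts.
\<close>

definition cumulant :: "('a \<Rightarrow> 'a \<Rightarrow> bool) \<Rightarrow> nat \<Rightarrow> 'a set \<Rightarrow> real" where
  "cumulant adj k = moebius (\<lambda>S. log_deriv adj S $ k)"

lemma sum_cumulant: "finite V \<Longrightarrow> log_deriv adj V $ k = (\<Sum>T\<in>Pow V. cumulant adj k T)"
  by (simp add: cumulant_def sum_Pow_moebius)

lemma cumulant_empty [simp]: "cumulant adj k {} = 0"
  by (simp add: cumulant_def moebius_def log_deriv_empty)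

lemma cumulant_large:
  "irreflp adj \<Longrightarrow> finite T \<Longrightarrow> 2 * Suc k < card T \<Longrightarrow> cumulant adj k T = 0"
  using set_degree_log_deriv[of adj k] by (simp only: cumulant_def set_degree_le_def)

lemma cumulant_disconnected:
  assumes "irreflp adj" "finite A" "finite B" "A \<inter> B = {}" "A \<noteq> {}" "B \<noteq> {}"
    and "\<And>u v. u \<in> A \<Longrightarrow> v \<in> B \<Longrightarrow> \<not> adj u v \<and> \<not> adj v u"
  shows "cumulant adj k (A \<union> B) = 0"
  unfolding cumulant_def
proof (rule moebius_eq_0_if_additive[OF assms(2-6)])
  fix U W assume "U \<subseteq> A" "W \<subseteq> B"
  then have "log_deriv adj (U \<union> W) = log_deriv adj U + log_deriv adj W"
    using assms by (intro log_deriv_Un) (blast intro: finite_subset)+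
  then show "log_deriv adj (U \<union> W) $ k = log_deriv adj U $ k + log_deriv adj W $ k" by simp
qed

lemma log_deriv_cong:
  assumes "\<And>u v. u \<in> S \<Longrightarrow> v \<in> S \<Longrightarrow> adj u v \<longleftrightarrow> adj' u v"
  shows "log_deriv adj S = log_deriv adj' S"
proof -
  have "chromatic_poly S adj = chromatic_poly S adj'" using assms by (rule chromatic_poly_cong)
  then show ?thesis by (simp only: log_deriv_def chrom_series_def)
qed

lemma log_deriv_image:
  assumes "finite S" "inj_on f S"
  shows "log_deriv adj (f ` S) = log_deriv (\<lambda>u v. adj (f u) (f v)) S"
  by (simp only: log_deriv_def chrom_series_def chromatic_poly_image[OF assms] card_image[OF assms(2)])

lemma cumulant_cong:
  assumes "\<And>u v. u \<in> T \<Longrightarrow> v \<in> T \<Longrightarrow> adj u v \<longleftrightarrow> adj' u v"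
  shows "cumulant adj k T = cumulant adj' k T"
  unfolding cumulant_def
proof (rule moebius_cong)
  fix U assume "U \<subseteq> T"
  then show "log_deriv adj U $ k = log_deriv adj' U $ k"
    using log_deriv_cong[of U adj adj'] assms by (simp add: subset_eq)
qed

lemma cumulant_image:
  assumes "finite T" "inj_on f T"
    and "\<And>u v. u \<in> T \<Longrightarrow> v \<in> T \<Longrightarrow> adj (f u) (f v) \<longleftrightarrow> adj u v"
  shows "cumulant adj k (f ` T) = cumulant adj k T"
proof -
  have "cumulant adj k (f ` T) = cumulant (\<lambda>u v. adj (f u) (f v)) k T"
    unfolding cumulant_def moebius_image[OF assms(2)]
  proof (rule moebius_cong)
    fix U assume "U \<subseteq> T"
    then show "log_deriv adj (f ` U) $ k = log_deriv (\<lambda>u v. adj (f u) (f v)) U $ k"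
      using assms by (subst log_deriv_image) (auto intro: finite_subset inj_on_subset)
  qed
  also have "\<dots> = cumulant adj k T" using assms(3) by (rule cumulant_cong)
  finally show ?thesis .
qed

text \<open>
  Each nonempty \<open>T\<close> is distributed evenly over its elements, with weight \<open>1 / |T|\<close>.
  Every vertex then receives the same total, because an automorphism moving \<open>p\<close> to \<open>v\<close>
  carries the sets through \<open>p\<close> bijectively to the sets through \<open>v\<close>.
\<close>

lemma log_deriv_vertex_transitive:
  assumes "finite V" "p \<in> V"
    and trans: "\<And>v. v \<in> V \<Longrightarrow> \<exists>f. bij_betw f V V \<and> f p = v \<and>
      (\<forall>x\<in>V. \<forall>y\<in>V. adj (f x) (f y) \<longleftrightarrow> adj x y)"
  shows "log_deriv adj V $ k =
    real (card V) * (\<Sum>T | T \<subseteq> V \<and> p \<in> T. cumulant adj k T / real (card T))"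
proof -
  let ?w = "\<lambda>T. cumulant adj k T / real (card T)"
  have "log_deriv adj V $ k = (\<Sum>T\<in>Pow V. \<Sum>v | v \<in> V \<and> v \<in> T. ?w T)"
    unfolding sum_cumulant[OF assms(1)]
  proof (intro sum.cong refl)
    fix T assume T: "T \<in> Pow V"
    then have "finite T" "{v. v \<in> V \<and> v \<in> T} = T" using assms(1) by (auto intro: finite_subset)
    then show "cumulant adj k T = (\<Sum>v | v \<in> V \<and> v \<in> T. ?w T)"
      by (cases "T = {}") simp_all
  qed
  also have "\<dots> = (\<Sum>v\<in>V. \<Sum>T | T \<in> Pow V \<and> v \<in> T. ?w T)"
    using assms(1) by (intro sum.swap_restrict) auto
  also have "\<dots> = (\<Sum>v\<in>V. \<Sum>T | T \<subseteq> V \<and> p \<in> T. ?w T)"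
  proof (rule sum.cong[OF refl])
    fix v assume "v \<in> V"
    then obtain f where f: "bij_betw f V V" "f p = v"
        and adj: "\<And>x y. x \<in> V \<Longrightarrow> y \<in> V \<Longrightarrow> adj (f x) (f y) \<longleftrightarrow> adj x y"
      using trans by metis
    have inj: "inj_on f V" and surj: "f ` V = V" using f(1) by (auto simp: bij_betw_def)
    have "(\<Sum>T | T \<in> Pow V \<and> v \<in> T. ?w T) = (\<Sum>T | T \<subseteq> V \<and> p \<in> T. ?w (f ` T))"
    proof (rule sum.reindex_bij_betw[symmetric], unfold bij_betw_def, intro conjI)
      show "inj_on ((`) f) {T. T \<subseteq> V \<and> p \<in> T}"
        by (rule inj_on_subset[OF inj_on_image_Pow[OF inj]]) auto
      show "(`) f ` {T. T \<subseteq> V \<and> p \<in> T} = {T. T \<in> Pow V \<and> v \<in> T}"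
      proof (intro equalityI subsetI)
        fix T assume "T \<in> {T. T \<in> Pow V \<and> v \<in> T}"
        then have "{x \<in> V. f x \<in> T} \<in> {T. T \<subseteq> V \<and> p \<in> T}" "T = f ` {x \<in> V. f x \<in> T}"
          using f(2) assms(2) surj by auto
        then show "T \<in> (`) f ` {T. T \<subseteq> V \<and> p \<in> T}" by (rule rev_image_eqI)
      qed (use surj f(2) in auto)
    qed
    also have "\<dots> = (\<Sum>T | T \<subseteq> V \<and> p \<in> T. ?w T)"
    proof (intro sum.cong refl)
      fix T assume "T \<in> {T. T \<subseteq> V \<and> p \<in> T}"
      then have "finite T" "inj_on f T" "T \<subseteq> V"
        using assms(1) inj by (auto intro: finite_subset inj_on_subset)
      then show "?w (f ` T) = ?w T"
        by (subst cumulant_image) (auto simp: card_image adj subset_eq)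
    qed
    finally show "(\<Sum>T | T \<in> Pow V \<and> v \<in> T. ?w T) = \<dots>" .
  qed
  finally show ?thesis by simp
qed

section \<open>The torus\<close>

lemma cong_small_iff:
  fixes a b n :: int
  assumes "\<bar>a - b\<bar> < n"
  shows "[a = b] (mod n) \<longleftrightarrow> a = b"
  using assms dvd_imp_le_int[of "a - b" n] by (auto simp: cong_iff_dvd_diff)

lemma finite_torus_verts: "finite (torus_verts d n)"
  by (simp add: torus_verts_def finite_PiE)

lemma card_torus_verts: "card (torus_verts d n) = n ^ d"
  by (simp add: torus_verts_def card_PiE)

lemma torus_adj_sym: "torus_adj d n u v \<longleftrightarrow> torus_adj d n v u"
proof -
  have "[u i - v i = 1] (mod int n) \<longleftrightarrow> [v i - u i = - 1] (mod int n)" for u v :: "nat \<Rightarrow> int" and i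
    using cong_minus_minus_iff[of "u i - v i" 1 "int n"] by simp
  then show ?thesis unfolding torus_adj_def by metis
qed

lemma irreflp_torus_adj:
  assumes "n \<ge> 2"
  shows "irreflp (torus_adj d n)"
proof (rule irreflpI)
  fix u :: "nat \<Rightarrow> int"
  have "\<not> [0 = 1] (mod int n)" "\<not> [0 = -1] (mod int n)"
    using assms by (simp_all add: cong_small_iff)
  then show "\<not> torus_adj d n u u" by (auto simp: torus_adj_def)
qed

lemma torus_translation:
  fixes m :: int
  assumes v: "v \<in> torus_verts d n" and m: "0 \<le> m" "m < int n"
  defines "f \<equiv> \<lambda>x. \<lambda>i\<in>{..<d}. (x i + (v i - m)) mod int n"
  shows "bij_betw f (torus_verts d n) (torus_verts d n)"
    and "f (\<lambda>i\<in>{..<d}. m) = v"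
    and "\<And>x y. x \<in> torus_verts d n \<Longrightarrow> y \<in> torus_verts d n \<Longrightarrow>
      torus_adj d n (f x) (f y) \<longleftrightarrow> torus_adj d n x y"
proof -
  have eq_iff: "(a + c) mod int n = (b + c) mod int n \<longleftrightarrow> a = b"
    if "a \<in> {0..<int n}" "b \<in> {0..<int n}" for a b c
  proof -
    have "[a + c = b + c] (mod int n) \<longleftrightarrow> [a = b] (mod int n)" by (rule cong_add_rcancel)
    then show ?thesis using that by (simp add: cong_small_iff) (simp add: cong_def)
  qed
  have "inj_on f (torus_verts d n)"
  proof (rule inj_onI)
    fix x y assume xy: "x \<in> torus_verts d n" "y \<in> torus_verts d n" "f x = f y"
    show "x = y"
    proof (rule PiE_ext[OF xy(1,2)[unfolded torus_verts_def]])
      fix i assume i: "i \<in> {..<d}"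
      then show "x i = y i"
        using xy(1,2) fun_cong[OF xy(3), of i] eq_iff[of "x i" "y i"]
        by (auto simp: f_def torus_verts_def PiE_iff)
    qed
  qed
  moreover have "f ` torus_verts d n \<subseteq> torus_verts d n"
  proof (rule image_subsetI)
    fix x
    have "0 < int n" using m by simp
    then show "f x \<in> torus_verts d n" by (simp add: f_def torus_verts_def PiE_iff)
  qed
  ultimately show "bij_betw f (torus_verts d n) (torus_verts d n)"
    using endo_inj_surj[OF finite_torus_verts] by (simp add: bij_betw_def)
  show "f (\<lambda>i\<in>{..<d}. m) = v"
    using v by (auto simp: f_def torus_verts_def PiE_iff extensional_def restrict_def fun_eq_iff)
  show "torus_adj d n (f x) (f y) \<longleftrightarrow> torus_adj d n x y"
    if "x \<in> torus_verts d n" "y \<in> torus_verts d n" for x y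
  proof -
    have "[f x i - f y i = x i - y i] (mod int n)" if "i < d" for i
      using that by (simp add: f_def cong_def mod_diff_eq)
    then have "[f x i - f y i = e] (mod int n) \<longleftrightarrow> [x i - y i = e] (mod int n)" if "i < d" for i e
      using that by (simp add: cong_def)
    moreover have "f x j = f y j \<longleftrightarrow> x j = y j" if "j < d" for j
      using that \<open>x \<in> _\<close> \<open>y \<in> _\<close> eq_iff[of "x j" "y j"]
      by (simp add: f_def torus_verts_def PiE_iff)
    ultimately show ?thesis unfolding torus_adj_def by (metis (no_types, lifting))
  qed
qed

definition grid_adj :: "nat \<Rightarrow> (nat \<Rightarrow> int) \<Rightarrow> (nat \<Rightarrow> int) \<Rightarrow> bool" where
  "grid_adj d u v \<longleftrightarrow> (\<exists>i<d. \<bar>u i - v i\<bar> = 1 \<and> (\<forall>j<d. j \<noteq> i \<longrightarrow> u j = v j))"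

text \<open>
  A box centred at the vertex with all coordinates \<open>m\<close>.  With this choice of the centre,
  rather than the origin, the box consists of vertices of every torus with \<open>n > 2m\<close>, and no
  identification of residues is needed.
\<close>

definition grid_box :: "nat \<Rightarrow> nat \<Rightarrow> (nat \<Rightarrow> int) set" where
  "grid_box d m = {..<d} \<rightarrow>\<^sub>E {0..2 * int m}"

text \<open>
  Coordinates in the box differ by at most \<open>2m\<close>, so a difference that is congruent to \<open>1\<close> or
  \<open>-1\<close> is equal to it as soon as \<open>n \<ge> 2m + 2\<close>.
\<close>

lemma torus_adj_eq_grid_adj:
  assumes "2 * m + 2 \<le> n" "u \<in> grid_box d m" "v \<in> grid_box d m"
  shows "torus_adj d n u v \<longleftrightarrow> grid_adj d u v"
proof -
  have "([u i - v i = 1] (mod int n) \<or> [u i - v i = -1] (mod int n)) \<longleftrightarrow> \<bar>u i - v i\<bar> = 1"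
    if "i < d" for i
  proof -
    have "u i \<in> {0..2 * int m}" "v i \<in> {0..2 * int m}"
      using assms(2,3) that by (auto simp: grid_box_def PiE_iff)
    then have "\<bar>u i - v i - 1\<bar> < int n" "\<bar>u i - v i - (-1)\<bar> < int n" using assms(1) by auto
    then show ?thesis by (subst (1 2) cong_small_iff) auto
  qed
  then show ?thesis unfolding torus_adj_def grid_adj_def by (metis (no_types, lifting))
qed

text \<open>
  One step in the torus changes the distance to the centre by at most one.  Inside the box, away
  from its boundary, a step cannot wrap around.
\<close>

lemma torus_adj_step:
  fixes j m n :: nat
  assumes "j < m" "2 * m + 2 \<le> n" "torus_adj d n u v"
    and v: "v \<in> torus_verts d n" and u: "\<And>i. i < d \<Longrightarrow> \<bar>u i - int m\<bar> \<le> int j"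
    and i: "i < d"
  shows "\<bar>v i - int m\<bar> \<le> int (Suc j)"
proof -
  obtain l where l: "l < d" "[u l - v l = 1] (mod int n) \<or> [u l - v l = -1] (mod int n)"
      "\<And>i. i < d \<Longrightarrow> i \<noteq> l \<Longrightarrow> u i = v i"
    using assms(3) by (auto simp: torus_adj_def)
  show ?thesis
  proof (cases "i = l")
    case True
    have "0 \<le> v l" "v l < int n" using v l(1) by (auto simp: torus_verts_def PiE_iff)
    then have "\<bar>u l - v l - 1\<bar> < int n" "\<bar>u l - v l - (-1)\<bar> < int n"
      using assms(1,2) u[OF l(1)] by auto
    then have "\<bar>u l - v l\<bar> = 1" using l(2) by (auto simp: cong_small_iff)
    then show ?thesis using u[OF l(1)] True by auto
  next
    case False
    then show ?thesis using u[OF i] l(3)[OF i] by simp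
  qed
qed

text \<open>
  The concentric boxes of radius \<open>0, 1, \<dots>, m\<close> cut \<open>T\<close> into an increasing chain of sets.  If
  each inclusion were strict, \<open>T\<close> would have more than \<open>m\<close> elements.  So some shell contains
  no element of \<open>T\<close>, and it separates the part of \<open>T\<close> around the centre from the part outside
  the box.
\<close>

lemma cumulant_outside_box:
  assumes n: "2 * m + 2 \<le> n" and T: "T \<subseteq> torus_verts d n" "card T \<le> m"
    and p: "(\<lambda>i\<in>{..<d}. int m) \<in> T" and out: "\<not> T \<subseteq> grid_box d m"
  shows "cumulant (torus_adj d n) k T = 0"
proof -
  let ?p = "\<lambda>i\<in>{..<d}. int m"
  have fin: "finite T" using T(1) finite_torus_verts finite_subset by blast
  \<comment> \<open>The part of \<open>T\<close> in the box of radius \<open>j\<close> around the centre.\<close>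
  define B where "B j = {v \<in> T. \<forall>i<d. \<bar>v i - int m\<bar> \<le> int j}" for j
  have B_mono: "B j \<subseteq> B (Suc j)" for j
    by (force simp: B_def)
  have finB: "finite (B j)" for j using fin by (simp add: B_def)
  have pB: "?p \<in> B j" for j using p by (simp add: B_def)
  have "\<exists>j<m. B j = B (Suc j)"
  proof (rule ccontr)
    assume "\<not> (\<exists>j<m. B j = B (Suc j))"
    then have strict: "B j \<subset> B (Suc j)" if "j < m" for j using B_mono that by blast
    have "j < card (B j)" if "j \<le> m" for j
      using that
    proof (induction j)
      case 0
      then show ?case using pB[of 0] finB[of 0] by (auto simp: card_gt_0_iff)
    next
      case (Suc j)
      then show ?case using psubset_card_mono[OF finB strict, of j] by simp
    qed
    then have "m < card (B m)" by simp
    also have "card (B m) \<le> card T" using fin by (intro card_mono) (auto simp: B_def)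
    finally show False using T(2) by simp
  qed
  then obtain j where j: "j < m" "B j = B (Suc j)" by blast
  have "cumulant (torus_adj d n) k (B j \<union> (T - B j)) = 0"
  proof (rule cumulant_disconnected)
    show "irreflp (torus_adj d n)" using n by (intro irreflp_torus_adj) simp
    show "B j \<noteq> {}" using pB by blast
    obtain v where v: "v \<in> T" "v \<notin> grid_box d m" using out by blast
    have "v \<notin> B j"
    proof
      assume "v \<in> B j"
      then have "\<bar>v i - int m\<bar> \<le> int m" if "i < d" for i using that j(1) by (force simp: B_def)
      moreover have "v i = undefined" if "\<not> i < d" for i
        using v(1) T(1) that by (auto simp: torus_verts_def PiE_iff extensional_def)
      ultimately have "v \<in> grid_box d m"
        by (force simp: grid_box_def PiE_iff extensional_def abs_le_iff)
      then show False using v(2) by blast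
    qed
    then show "T - B j \<noteq> {}" using v(1) by blast
    fix u v assume u: "u \<in> B j" and v: "v \<in> T - B j"
    \<comment> \<open>A neighbour in \<open>T\<close> of the inner part would have to lie in the empty shell.\<close>
    have "\<not> torus_adj d n u v"
    proof
      assume adj: "torus_adj d n u v"
      have "v \<in> B (Suc j)"
        using torus_adj_step[OF j(1) n adj] u v T(1) unfolding B_def by blast
      then show False using v j(2) by simp
    qed
    then show "\<not> torus_adj d n u v \<and> \<not> torus_adj d n v u" using torus_adj_sym by blast
  qed (use fin finB in auto)
  moreover have "B j \<union> (T - B j) = T" by (auto simp: B_def)
  ultimately show ?thesis by simp
qed

text \<open>
  The contribution of one vertex to the logarithmic derivative.  The sets that matter have at most \<open>2(k + 1)\<close> elements, which
  dictates the radius of the box.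
\<close>

definition grid_log_density :: "nat \<Rightarrow> nat \<Rightarrow> real" where
  "grid_log_density d k = (let m = 2 * Suc k in
     (\<Sum>T | T \<subseteq> grid_box d m \<and> (\<lambda>i\<in>{..<d}. int m) \<in> T.
        cumulant (grid_adj d) k T / real (card T)))"

lemma log_deriv_torus:
  assumes n: "4 * k + 6 \<le> n"
  shows "log_deriv (torus_adj d n) (torus_verts d n) $ k = real (n ^ d) * grid_log_density d k"
proof -
  define m where "m = 2 * Suc k"
  \<comment> \<open>This room around the box, with \<open>2 m + 2 = 4 k + 6\<close>, keeps the torus from wrapping around.\<close>
  have n': "2 * m + 2 \<le> n" using n by (simp add: m_def)
  define p where "p = (\<lambda>i\<in>{..<d}. int m)"
  have p: "p \<in> torus_verts d n" using n' by (auto simp: p_def torus_verts_def)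
  have box: "grid_box d m \<subseteq> torus_verts d n"
    unfolding grid_box_def torus_verts_def using n' by (intro PiE_mono) auto
  have "log_deriv (torus_adj d n) (torus_verts d n) $ k = real (card (torus_verts d n)) *
      (\<Sum>T | T \<subseteq> torus_verts d n \<and> p \<in> T. cumulant (torus_adj d n) k T / real (card T))"
  proof (rule log_deriv_vertex_transitive[OF finite_torus_verts p])
    fix v assume v: "v \<in> torus_verts d n"
    have "0 \<le> int m" "int m < int n" using n' by auto
    from torus_translation[OF v this]
    show "\<exists>f. bij_betw f (torus_verts d n) (torus_verts d n) \<and> f p = v \<and>
        (\<forall>x\<in>torus_verts d n. \<forall>y\<in>torus_verts d n. torus_adj d n (f x) (f y) \<longleftrightarrow> torus_adj d n x y)"
      unfolding p_def by blast
  qed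
  also have "(\<Sum>T | T \<subseteq> torus_verts d n \<and> p \<in> T. cumulant (torus_adj d n) k T / real (card T)) =
      (\<Sum>T | T \<subseteq> grid_box d m \<and> p \<in> T. cumulant (torus_adj d n) k T / real (card T))"
  proof (rule sum.mono_neutral_right)
    show "finite {T. T \<subseteq> torus_verts d n \<and> p \<in> T}"
      using finite_torus_verts by (simp add: finite_subset[of _ "Pow (torus_verts d n)"] subset_eq)
    show "\<forall>T\<in>{T. T \<subseteq> torus_verts d n \<and> p \<in> T} - {T. T \<subseteq> grid_box d m \<and> p \<in> T}.
        cumulant (torus_adj d n) k T / real (card T) = 0"
    proof
      fix T assume "T \<in> {T. T \<subseteq> torus_verts d n \<and> p \<in> T} - {T. T \<subseteq> grid_box d m \<and> p \<in> T}"
      then have T: "T \<subseteq> torus_verts d n" "p \<in> T" "\<not> T \<subseteq> grid_box d m" by auto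
      have "cumulant (torus_adj d n) k T = 0"
      proof (cases "card T \<le> m")
        case True
        then show ?thesis using cumulant_outside_box[OF n' T(1) _ T(2)[unfolded p_def] T(3)] by blast
      next
        case False
        moreover have "finite T" using T(1) finite_torus_verts finite_subset by blast
        ultimately show ?thesis
          using n' by (intro cumulant_large irreflp_torus_adj) (auto simp: m_def)
      qed
      then show "cumulant (torus_adj d n) k T / real (card T) = 0" by simp
    qed
  qed (use box in auto)
  also have "\<dots> = (\<Sum>T | T \<subseteq> grid_box d m \<and> p \<in> T. cumulant (grid_adj d) k T / real (card T))"
  proof (intro sum.cong refl)
    fix T assume T: "T \<in> {T. T \<subseteq> grid_box d m \<and> p \<in> T}"
    have "cumulant (torus_adj d n) k T = cumulant (grid_adj d) k T"
      using T by (intro cumulant_cong torus_adj_eq_grid_adj[OF n']) auto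
    then show "cumulant (torus_adj d n) k T / real (card T) = cumulant (grid_adj d) k T / real (card T)"
      by simp
  qed
  also have "\<dots> = grid_log_density d k"
    by (simp only: grid_log_density_def Let_def m_def p_def)
  finally show ?thesis by (simp add: card_torus_verts)
qed

section \<open>Sequences of binomial type\<close>

text \<open>
  The coefficients of \<open>exp (x L(t))\<close> as a power series in \<open>t\<close>, where \<open>L(0) = 0\<close> and
  \<open>L'\<close> has the coefficients \<open>M\<close>: with \<open>H\<close> for this series, the recursion is
  \<open>H' = x L' H\<close>.
\<close>

fun exp_poly :: "(nat \<Rightarrow> 'a::field_char_0) \<Rightarrow> nat \<Rightarrow> 'a poly" where
  "exp_poly M 0 = 1"
| "exp_poly M (Suc k) = smult (1 / of_nat (Suc k)) (\<Sum>j\<le>k. pCons 0 (smult (M j) (exp_poly M (k - j))))"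

text \<open>
  The differential equation has only one solution with constant term \<open>1\<close>.  Only the equations
  below the index \<open>k\<close> enter, which is what makes the statement applicable to a torus of fixed
  size, where the logarithm is known up to a finite order.
\<close>

lemma poly_exp_poly_eqI:
  fixes h :: "nat \<Rightarrow> 'a::field_char_0"
  assumes "h 0 = 1"
    and "\<And>i. i < k \<Longrightarrow> of_nat (Suc i) * h (Suc i) = (\<Sum>j\<le>i. x * M j * h (i - j))"
  shows "h k = poly (exp_poly M k) x"
  using assms
proof (induction k rule: less_induct)
  case (less k)
  have IH: "h l = poly (exp_poly M l) x" if "l < k" for l
  proof (rule less.IH[OF that less.prems(1)])
    fix i assume "i < l"
    then show "of_nat (Suc i) * h (Suc i) = (\<Sum>j\<le>i. x * M j * h (i - j))"
      using that by (intro less.prems(2)) simp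
  qed
  show ?case
  proof (cases k)
    case 0
    then show ?thesis using less.prems(1) by simp
  next
    case (Suc i)
    have "of_nat (Suc i) * h (Suc i) = (\<Sum>j\<le>i. x * M j * h (i - j))"
      using Suc by (intro less.prems(2)) simp
    also have "\<dots> = (\<Sum>j\<le>i. x * M j * poly (exp_poly M (i - j)) x)"
      using IH Suc by (intro sum.cong refl) simp
    finally have "of_nat (Suc i) * h (Suc i) = (\<Sum>j\<le>i. x * M j * poly (exp_poly M (i - j)) x)" .
    moreover have "(of_nat (Suc i) :: 'a) \<noteq> 0" by (simp only: of_nat_eq_0_iff)
    ultimately have "h (Suc i) = (\<Sum>j\<le>i. x * M j * poly (exp_poly M (i - j)) x) / of_nat (Suc i)"
      by (metis nonzero_mult_div_cancel_left)
    then show ?thesis by (simp add: Suc poly_sum mult.assoc del: of_nat_Suc)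
  qed
qed

lemma exp_poly_recursion:
  fixes M :: "nat \<Rightarrow> 'a::field_char_0"
  shows "of_nat (Suc k) * poly (exp_poly M (Suc k)) x =
    (\<Sum>j\<le>k. x * M j * poly (exp_poly M (k - j)) x)"
proof -
  have "(of_nat (Suc k) :: 'a) \<noteq> 0" by (simp only: of_nat_eq_0_iff)
  then show ?thesis by (simp add: poly_sum mult.assoc del: of_nat_Suc)
qed

text \<open>
  The \<open>m\<close>-th power of the solution for \<open>x = 1\<close> satisfies the equation for \<open>x = m\<close>.
\<close>

lemma binomial_type_exp_poly: "binomial_type (exp_poly M)"
  unfolding binomial_type_def
proof (intro conjI allI impI)
  show "poly (exp_poly M i) 0 = 0" if "i > 0" for i
    using that by (cases i) (simp_all add: poly_sum)
  fix m
  define f where "f = Abs_fps (\<lambda>i. poly (exp_poly M i) 1)"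
  have deriv: "fps_deriv f = Abs_fps M * f"
    using exp_poly_recursion[of _ M 1] by (intro fps_ext) (simp add: f_def fps_mult_nth atLeast0AtMost)
  have deriv_pow: "fps_deriv (f ^ m) = fps_const (of_nat m) * Abs_fps M * f ^ m"
  proof (cases m)
    case (Suc l)
    have "fps_deriv (f ^ m) = fps_const (of_nat m) * (Abs_fps M * f) * f ^ (m - 1)"
      by (simp only: fps_deriv_power deriv)
    then show ?thesis by (simp only: Suc diff_Suc_1 power_Suc mult_ac)
  qed simp
  have "(f ^ m) $ k = poly (exp_poly M k) (of_nat m)" for k
  proof (rule poly_exp_poly_eqI)
    show "(f ^ m) $ 0 = 1" by (simp add: fps_nth_power_0 f_def)
    fix i
    have "fps_deriv (f ^ m) $ i = (fps_const (of_nat m) * (Abs_fps M * f ^ m)) $ i"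
      by (simp add: deriv_pow mult.assoc)
    then show "of_nat (Suc i) * (f ^ m) $ Suc i = (\<Sum>j\<le>i. of_nat m * M j * (f ^ m) $ (i - j))"
      by (simp add: fps_mult_nth[of "Abs_fps M"] atLeast0AtMost sum_distrib_left mult.assoc)
  qed
  then show "Abs_fps (\<lambda>i. poly (exp_poly M i) 1) ^ m = Abs_fps (\<lambda>i. poly (exp_poly M i) (of_nat m))"
    by (intro fps_ext) (simp add: f_def)
qed simp

theorem theorem6p8:
  fixes d :: nat
  assumes "d \<ge> 1"
  shows "\<exists>P :: nat \<Rightarrow> real poly.
           (\<forall>k. \<exists>n\<^sub>k::nat. \<forall>n\<ge>3. n \<ge> n\<^sub>k \<longrightarrow>
              (-1) ^ k * real_of_int (torus_coeff d n k) = poly (P k) (real (n ^ d))) \<and>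
           binomial_type P"
proof (intro exI[of _ "exp_poly (grid_log_density d)"] conjI allI binomial_type_exp_poly)
  fix k
  show "\<exists>n\<^sub>k. \<forall>n\<ge>3. n \<ge> n\<^sub>k \<longrightarrow> (-1) ^ k * real_of_int (torus_coeff d n k) =
      poly (exp_poly (grid_log_density d) k) (real (n ^ d))"
  proof (intro exI[of _ "4 * k + 6"] allI impI)
    fix n :: nat assume n: "4 * k + 6 \<le> n"
    let ?F = "chrom_series (torus_adj d n) (torus_verts d n)"
    have irrefl: "irreflp (torus_adj d n)" using n by (intro irreflp_torus_adj) simp
    have "(-1) ^ k * real_of_int (torus_coeff d n k) = ?F $ k"
      by (simp add: torus_coeff_def torus_chromatic_poly_def chrom_series_def card_torus_verts)
    also have "\<dots> = poly (exp_poly (grid_log_density d) k) (real (n ^ d))"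
    proof (rule poly_exp_poly_eqI)
      show "?F $ 0 = 1" by (rule chrom_series_nth_0[OF finite_torus_verts irrefl])
      fix i assume "i < k"
      then have "log_deriv (torus_adj d n) (torus_verts d n) $ j = real (n ^ d) * grid_log_density d j"
        if "j \<le> i" for j
        using that n by (intro log_deriv_torus) simp
      then show "of_nat (Suc i) * ?F $ Suc i =
          (\<Sum>j\<le>i. real (n ^ d) * grid_log_density d j * ?F $ (i - j))"
        unfolding log_deriv_recursion[OF finite_torus_verts irrefl] by (intro sum.cong) auto
    qed
    finally show "(-1) ^ k * real_of_int (torus_coeff d n k) =
        poly (exp_poly (grid_log_density d) k) (real (n ^ d))" .
  qed
qed

end
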